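(* Let $q$ be a prime power, let $n>1$ be an integer that is not a prime power, let $1<k<\sigma_0(n)$ (where $\sigma_0(n)$ is the number of positive divisors of $n$), let $\mathbf{d}=(d_1,\ldots,d_k)\in\Lambda_k(n)$, and let $\mathbf{a}=(a_1,\ldots,a_k)\in\mathbb{F}(\mathbf{d})$ be a $\mathbf{d}$-admissible $k$-tuple. If $$q^{n/2-\lambda(\mathbf{d})}\ge W(q^n-1),$$ where $W(t)$ denotes the number of squarefree positive divisors of $t$, then there exists a primitive element $\alpha\in\mathbb{F}_{q^n}$ (i.e., a generator of the cyclic group $\mathbb{F}_{q^n}^*$) such that $\mathrm{Tr}_{n/d_i}(\alpha)=a_i$ for every $1\le i\le k$.
   Context: $\mathbb{F}_q$ is the finite field with $q$ elements. For a divisor $d$ of $n$ and $\alpha\in\mathbb{F}_{q^n}$, $\mathrm{Tr}_{n/d}(\alpha)=\sum_{i=0}^{n/d-1}\alpha^{q^{di}}$ is the trace of $\alpha$ over $\mathbb{F}_{q^d}$. $\Lambda_k(n)$ is the set of $k$-tuples $\mathbf{d}=(d_1,\ldots,d_k)$ of divisors $d_1<\cdots<d_k<n$ of $n$ such that $d_i\nmid d_j$ for all $i\ne j$. For $\mathbf{d}\in\Lambda_k(n)$, $\mathbb{F}(\mathbf{d})=\prod_{i=1}^k\mathbb{F}_{q^{d_i}}$ and $$\lambda(\mathbf{d})=d_1+\cdots+d_k+\sum_{i=2}^{k}(-1)^{i+1}\sum_{1\le\ell_1<\cdots<\ell_i\le k}\gcd(d_{\ell_1},\ldots,d_{\ell_i})$$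 (equivalently, the degree of $\mathrm{lcm}(x^{d_1}-1,\ldots,x^{d_k}-1)$). A tuple $\mathbf{a}=(a_1,\ldots,a_k)\in\mathbb{F}(\mathbf{d})$ is $\mathbf{d}$-admissible if $\mathrm{Tr}_{d_i/\gcd(d_i,d_j)}(a_i)=\mathrm{Tr}_{d_j/\gcd(d_i,d_j)}(a_j)$ for all $1\le i<j\le k$ (traces taken within $\mathbb{F}_{q^{d_i}}$, resp. $\mathbb{F}_{q^{d_j}}$, over $\mathbb{F}_{q^{\gcd(d_i,d_j)}}$). *)

theory Defs
  imports
    Complex_Main
    "HOL-Computational_Algebra.Computational_Algebra"
    "HOL-Computational_Algebra.Squarefree"
    "HOL-Number_Theory.Prime_Powers"
begin

definition is_subfield :: "'a :: field set \<Rightarrow> bool" where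
  "is_subfield K \<longleftrightarrow>
     0 \<in> K \<and> 1 \<in> K \<and>
     (\<forall>x\<in>K. \<forall>y\<in>K. x - y \<in> K \<and> x * y \<in> K) \<and>
     (\<forall>x\<in>K. inverse x \<in> K)"

text \<open>
  The ambient field \<open>\<F>\<^bsub>q^n\<^esub>\<close> is a type of class \<^class>\<open>finite_field\<close> with \<open>q ^ n\<close> elements,
  and \<open>\<F>\<^bsub>m\<^esub>\<close> is its subfield with \<open>m\<close> elements. For \<open>m = q ^ d\<close> with \<open>d\<close> dividing \<open>n\<close>, this
  subfield exists and is unique; see \<open>ex1_subfield_of_card\<close> below.
\<close>

definition GF_sub :: "nat \<Rightarrow> 'a :: finite_field set" where
  "GF_sub m = (THE K. is_subfield K \<and> card K = m)"

text \<open>\<open>tr q m d\<close> is the trace \<open>Tr\<^bsub>m/d\<^esub>\<close> from \<open>\<F>\<^bsub>q^m\<^esub>\<close> down to \<open>\<F>\<^bsub>q^d\<^esub>\<close>, for \<open>d\<close> dividing \<open>m\<close>.\<close>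

definition tr :: "nat \<Rightarrow> nat \<Rightarrow> nat \<Rightarrow> 'a :: finite_field \<Rightarrow> 'a" where
  "tr q m d \<alpha> = (\<Sum>i<m div d. \<alpha> ^ (q ^ (d * i)))"

text \<open>
  A \<open>k\<close>-tuple is a function on \<^typ>\<open>nat\<close> of which only the values on \<open>{1..k}\<close> matter.
\<close>

definition Lam :: "nat \<Rightarrow> nat \<Rightarrow> (nat \<Rightarrow> nat) set" where
  "Lam k n = {d. strict_mono_on {1..k} d \<and>
                 (\<forall>i\<in>{1..k}. d i dvd n \<and> d i < n) \<and>
                 (\<forall>i\<in>{1..k}. \<forall>j\<in>{1..k}. i \<noteq> j \<longrightarrow> \<not> d i dvd d j)}"

definition FF :: "nat \<Rightarrow> nat \<Rightarrow> (nat \<Rightarrow> nat) \<Rightarrow> (nat \<Rightarrow> 'a :: finite_field) set" where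
  "FF q k d = {a. \<forall>i\<in>{1..k}. a i \<in> GF_sub (q ^ d i)}"

text \<open>
  An index sequence \<open>1 \<le> l\<^sub>1 < \<dots> < l\<^sub>i \<le> k\<close> is identified with the \<open>i\<close>-element subset
  \<open>L\<close> of \<open>{1..k}\<close> it enumerates.
\<close>

definition lam :: "nat \<Rightarrow> (nat \<Rightarrow> nat) \<Rightarrow> int" where
  "lam k d = (\<Sum>i=1..k. int (d i)) +
     (\<Sum>i=2..k. (-1) ^ (i + 1) *
        (\<Sum>L | L \<subseteq> {1..k} \<and> card L = i. int (GCD l\<in>L. d l)))"

definition admissible :: "nat \<Rightarrow> nat \<Rightarrow> (nat \<Rightarrow> nat) \<Rightarrow> (nat \<Rightarrow> 'a :: finite_field) \<Rightarrow> bool" where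
  "admissible q k d a \<longleftrightarrow>
     (\<forall>i j. 1 \<le> i \<and> i < j \<and> j \<le> k \<longrightarrow>
        tr q (d i) (gcd (d i) (d j)) (a i) = tr q (d j) (gcd (d i) (d j)) (a j))"

definition W :: "nat \<Rightarrow> nat" where
  "W t = card {m. m dvd t \<and> squarefree m}"

text \<open>
  The condition excludes \<open>\<alpha> = 0\<close>, because \<open>0 powi 1 = 0\<close> would lie in the range.
\<close>

definition primitive_element :: "'a :: finite_field \<Rightarrow> bool" where
  "primitive_element \<alpha> \<longleftrightarrow> range (\<lambda>j::int. \<alpha> powi j) = UNIV - {0}"

lemma CHAR_eq_of_card:
  assumes "card (UNIV :: 'a :: finite_field set) = (p ^ e) ^ n" "prime p"
  shows   "CHAR('a) = p"
proof -
  have "prime CHAR('a)" by simp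
  moreover have "CHAR('a) dvd (p ^ e) ^ n"
  proof -
    have "(\<Sum>x::'a\<in>UNIV. x + 1) = (\<Sum>x\<in>UNIV. x)"
      by (rule sum.reindex_bij_witness[of _ "\<lambda>x. x - 1" "\<lambda>x. x + 1"]) auto
    hence "of_nat (card (UNIV :: 'a set)) = (0 :: 'a)"
      by (simp add: sum.distrib)
    thus ?thesis using assms(1) by (metis of_nat_eq_0_iff_char_dvd)
  qed
  ultimately have "CHAR('a) dvd p"
    by (metis prime_dvd_power)
  with assms(2) \<open>prime CHAR('a)\<close> show ?thesis
    by (simp add: primes_dvd_imp_eq)
qed

lemma is_subfield_fixed_points:
  assumes "m = CHAR('a :: finite_field) ^ e"
  shows   "is_subfield {x :: 'a. x ^ m = x}"
proof -
  have add: "(x + y) ^ m = x ^ m + y ^ m" for x y :: 'a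
    by (rule freshmans_dream'[OF _ assms]) simp
  have m: "m > 0" using assms by simp
  have diff: "(x - y) ^ m = x ^ m - y ^ m" for x y :: 'a
    using add[of "x - y" y] by (simp add: algebra_simps)
  show ?thesis
    unfolding is_subfield_def using m by (auto simp: diff power_mult_distrib power_inverse)
qed

lemma subfield_subset_fixed_points:
  assumes "is_subfield (K :: 'a :: finite_field set)" "card K = m"
  shows   "K \<subseteq> {x. x ^ m = x}"
proof
  fix x assume x: "x \<in> K"
  have fin: "finite K" by simp
  have 0: "0 \<in> K" using assms(1) by (simp add: is_subfield_def)
  have m: "m > 0" using 0 fin assms(2) card_gt_0_iff by blast
  show "x \<in> {x. x ^ m = x}"
  proof (cases "x = 0")
    case False
    have clos: "x * y \<in> K" if "y \<in> K" for y using assms(1) x that by (simp add: is_subfield_def)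
    have inj: "inj_on ((*) x) (K - {0})" using False by (auto simp: inj_on_def)
    have "(*) x ` (K - {0}) = K - {0}"
      by (rule card_subset_eq) (use clos False inj in \<open>auto simp: card_image\<close>)
    hence "(\<Prod>y\<in>K-{0}. y) = (\<Prod>y\<in>K-{0}. x * y)"
      using prod.reindex[OF inj, of "\<lambda>y. y"] by (simp add: o_def)
    also have "\<dots> = x ^ (m - 1) * (\<Prod>y\<in>K-{0}. y)"
      using 0 assms(2) by (simp add: prod.distrib)
    finally have "x ^ (m - 1) = 1" by simp
    hence "x * x ^ (m - 1) = x" by simp
    thus ?thesis using m by (simp flip: power_Suc)
  qed (use m in auto)
qed

lemma card_fixed_points_le:
  assumes "m > 1"
  shows   "card {x :: 'a :: finite_field. x ^ m = x} \<le> m"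
proof -
  let ?p = "monom 1 m + [:0, - 1:] :: 'a poly"
  have "degree ?p = m"
    using assms degree_add_eq_left[of "[:0, - 1:]" "monom 1 m :: 'a poly"]
    by (simp add: degree_monom_eq)
  moreover from this have "?p \<noteq> 0" using assms by auto
  moreover have "{x. poly ?p x = 0} = {x. x ^ m = x}"
    by (auto simp: poly_monom)
  ultimately show ?thesis using card_poly_roots_bound[of ?p] by simp
qed

lemma card_fixed_points_ge:
  assumes "card (UNIV :: 'a :: finite_field set) = m ^ r" "m > 1" "r > 0"
  shows   "card {x :: 'a. x ^ m = x} \<ge> m"
proof -
  let ?p = "\<lambda>N. monom 1 N - 1 :: 'a poly"
  have deg: "degree (?p N) = N" if "N > 0" for N
    using that degree_add_eq_left[of "- 1" "monom 1 N :: 'a poly"]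
    by (simp add: degree_monom_eq)
  have nz: "?p N \<noteq> 0" if "N > 0" for N
    using deg[OF that] that by auto
  define Q where "Q = m ^ r"
  have Qm: "Q \<ge> m" unfolding Q_def using assms by (metis One_nat_def Suc_leI less_or_eq_imp_le power_increasing power_one_right)
  have "int m - 1 dvd int m ^ r - 1"
    using power_diff_1_eq[of "int m" r] by (simp add: dvd_def) 
  hence "int (m - 1) dvd int (Q - 1)"
    using Qm assms(2) by (simp add: of_nat_diff Q_def)
  hence "m - 1 dvd Q - 1" by (simp only: int_dvd_int_iff)
  then obtain s where s: "Q - 1 = (m - 1) * s" by blast
  have "?p (Q - 1) = (monom 1 (m - 1)) ^ s - 1"
    unfolding s by (simp add: monom_power)
  also have "\<dots> = ?p (m - 1) * (\<Sum>i<s. monom 1 (m - 1) ^ i)"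
    by (rule power_diff_1_eq)
  finally obtain g where g: "?p (Q - 1) = ?p (m - 1) * g" by blast
  have nz': "?p (Q - 1) \<noteq> 0" "?p (m - 1) \<noteq> 0" using nz Qm assms(2) by auto
  hence gnz: "g \<noteq> 0" using g by auto
  have "degree (?p (Q - 1)) = degree (?p (m - 1)) + degree g"
    unfolding g using nz' gnz by (intro degree_mult_eq) auto
  hence dg: "Q - 1 = (m - 1) + degree g" using deg Qm assms(2) by simp
  have "UNIV - {0} \<subseteq> {x. poly (?p (Q - 1)) x = 0}"
  proof
    fix x :: 'a assume "x \<in> UNIV - {0}"
    moreover have "x ^ Q = x" using finite_field_power_card_eq_same[of x] assms(1) Q_def by simp
    moreover have "x ^ Q = x * x ^ (Q - 1)" using Qm assms(2) by (simp flip: power_Suc)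
    ultimately have "x ^ (Q - 1) = 1" by simp
    thus "x \<in> {x. poly (?p (Q - 1)) x = 0}" by (simp add: poly_monom)
  qed
  also have "\<dots> = {x. poly (?p (m - 1)) x = 0} \<union> {x. poly g x = 0}"
    unfolding g by auto
  finally have "card (UNIV - {0 :: 'a}) \<le> card ({x. poly (?p (m - 1)) x = 0} \<union> {x. poly g x = 0})"
    by (intro card_mono) auto
  also have "\<dots> \<le> card {x. poly (?p (m - 1)) x = 0} + card {x. poly g x = 0}"
    by (rule card_Un_le)
  also have "card {x. poly g x = 0} \<le> degree g" using gnz by (rule card_poly_roots_bound)
  finally have "Q - 1 \<le> card {x. poly (?p (m - 1)) x = 0} + degree g"
    using assms(1) Q_def by simp
  hence c: "m - 1 \<le> card {x. poly (?p (m - 1)) x = 0}" using dg by simp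
  have "insert 0 {x. poly (?p (m - 1)) x = 0} \<subseteq> {x. x ^ m = x}"
  proof -
    have "x ^ m = x" if "x ^ (m - 1) = 1" for x :: 'a
    proof -
      have "x ^ m = x * x ^ (m - 1)" using assms(2) by (simp flip: power_Suc)
      thus ?thesis using that by simp
    qed
    thus ?thesis using assms(2) by (auto simp: poly_monom)
  qed
  hence "card (insert 0 {x. poly (?p (m - 1)) x = 0}) \<le> card {x :: 'a. x ^ m = x}"
    by (intro card_mono) auto
  moreover have "0 \<notin> {x. poly (?p (m - 1)) x = 0}"
    using assms(2) by (auto simp: poly_monom power_0_left)
  ultimately show ?thesis using c by simp
qed

lemma subfield_of_card_iff:
  assumes "primepow q" "n > 0" "card (UNIV :: 'a :: finite_field set) = q ^ n" "d dvd n"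
  shows   "is_subfield K \<and> card K = q ^ d \<longleftrightarrow> K = {x :: 'a. x ^ (q ^ d) = x}"
proof -
  obtain p e where q: "prime p" "e > 0" "q = p ^ e"
    using assms(1) by (auto simp: primepow_def)
  have "q > 1" using q by (metis one_less_power prime_gt_1_nat)
  moreover have d: "d > 0" using assms(2,4) by (auto intro: Nat.gr0I)
  ultimately have m: "q ^ d > 1" by (metis one_less_power)
  have "CHAR('a) = p" using CHAR_eq_of_card[of p e n] q assms(3) by simp
  hence sub: "is_subfield {x :: 'a. x ^ (q ^ d) = x}"
    by (intro is_subfield_fixed_points[of _ "e * d"]) (simp add: q power_mult)
  obtain r where r: "n = d * r" using assms(4) by blast
  have "card {x :: 'a. x ^ (q ^ d) = x} = q ^ d"
    using card_fixed_points_le[OF m, where ?'a = 'a] card_fixed_points_ge[of "q ^ d" r, where ?'a = 'a]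
      m r assms(2,3) by (simp add: power_mult)
  thus ?thesis
    using sub subfield_subset_fixed_points[of K "q ^ d"] card_subset_eq[of "{x. x ^ (q ^ d) = x}" K]
    by auto
qed

lemma ex1_subfield_of_card:
  assumes "primepow q" "n > 0" "card (UNIV :: 'a :: finite_field set) = q ^ n" "d dvd n"
  shows   "\<exists>!K :: 'a set. is_subfield K \<and> card K = q ^ d"
  using subfield_of_card_iff[OF assms] by auto

lemma GF_sub_eq:
  assumes "primepow q" "n > 0" "card (UNIV :: 'a :: finite_field set) = q ^ n" "d dvd n"
  shows   "GF_sub (q ^ d) = {x :: 'a. x ^ (q ^ d) = x}"
  unfolding GF_sub_def using subfield_of_card_iff[OF assms] by simp

end

theory Submission
  imports
    Defs
    "HOL-Library.FuncSet"
    "HOL-Number_Theory.Cong"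
    "HOL-Computational_Algebra.Field_as_Ring"
    "HOL-Algebra.Multiplicative_Group"
begin

text \<open>
  Let \<open>K\<close> be the prime field and let \<open>x\<close> act on the ambient field by the Frobenius map \<open>\<alpha> \<mapsto> \<alpha>\<^sup>q\<close>, so
  that the field becomes a \<open>K[x]\<close>-module killed by \<open>x\<^sup>n - 1\<close>. A polynomial of degree \<open>m\<close> has a kernel
  of at most \<open>q\<^sup>m\<close> elements, and counting shows that the kernel of each divisor of \<open>x\<^sup>n - 1\<close> is the
  image of the complementary divisor and has exactly \<open>q\<^sup>m\<close> elements. The trace \<open>Tr\<^bsub>n/d\<^esub>\<close> is the action
  of \<open>(x\<^sup>n - 1) / (x\<^sup>d - 1)\<close>. Hence admissible prescriptions are solvable by Bezout identities, and
  the solutions form a coset of a subgroup with at least \<open>q\<close> to the power \<open>n - \<lambda>(d)\<close> elements,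
  where \<open>\<lambda>(d)\<close> is the degree of the lcm of the \<open>x\<^sup>d - 1\<close>.

  A nontrivial multiplicative character has a sum of modulus at most \<open>\<surd>Q\<close>, \<open>Q = q\<^sup>n\<close>, over each coset
  of an additive subgroup. If \<open>p\<close> is a prime divisor of \<open>Q - 1\<close> and \<open>c\<^sub>p\<close> is the sum of the \<open>p - 1\<close>
  characters of order \<open>p\<close>, then the product of \<open>1 - c\<^sub>p / (p - 1)\<close> over all such \<open>p\<close> vanishes at every
  nonzero element that is not primitive. Expanding the product over sets of primes, every
  nonempty set contributes at most \<open>\<surd>Q\<close> to the sum over the coset, so a coset without primitive
  elements has at most \<open>1 + (W(Q - 1) - 1) \<surd>Q\<close> elements.
\<close>

section \<open>The prime field as a type\<close>

hide_const (open) module.smult up_ring.monom up_ring.coeff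

text \<open>
  The coefficients have to form a type of their own, because gcds of polynomials are only
  available over types of class \<^class>\<open>field_gcd\<close>.
\<close>

typedef (overloaded) ('a :: finite_field) prime_field = "range (of_int :: int \<Rightarrow> 'a)"
  by auto

setup_lifting type_definition_prime_field

instantiation prime_field :: (finite_field) field
begin

lift_definition zero_prime_field :: "'a prime_field" is 0
  by (rule range_eqI[of _ _ 0]) simp

lift_definition one_prime_field :: "'a prime_field" is 1
  by (rule range_eqI[of _ _ 1]) simp

lift_definition plus_prime_field :: "'a prime_field \<Rightarrow> 'a prime_field \<Rightarrow> 'a prime_field" is "(+)"
  by (auto simp flip: of_int_add)

lift_definition minus_prime_field :: "'a prime_field \<Rightarrow> 'a prime_field \<Rightarrow> 'a prime_field" is "(-)"
  by (auto simp flip: of_int_diff)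

lift_definition uminus_prime_field :: "'a prime_field \<Rightarrow> 'a prime_field" is uminus
  by (auto simp flip: of_int_minus)

lift_definition times_prime_field :: "'a prime_field \<Rightarrow> 'a prime_field \<Rightarrow> 'a prime_field" is "(*)"
  by (auto simp flip: of_int_mult)

lift_definition inverse_prime_field :: "'a prime_field \<Rightarrow> 'a prime_field" is inverse
proof -
  fix x :: 'a assume "x \<in> range of_int"
  then obtain z where z: "x = of_int z" by auto
  show "inverse x \<in> range of_int"
  proof (cases "x = 0")
    case True
    thus ?thesis by (intro range_eqI[of _ _ 0]) simp
  next
    case False
    \<comment> \<open>Every \<open>x\<close> satisfies \<open>x ^ Q = x\<close>, so the inverse of a
      nonzero \<open>x\<close> is \<open>x ^ (Q - 2)\<close>, again the image of an integer.\<close>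
    define Q where "Q = card (UNIV :: 'a set)"
    have "card {0, 1 :: 'a} \<le> Q" unfolding Q_def by (rule card_mono) auto
    hence "Q = Suc (Suc (Q - 2))" by simp
    hence "x * x * x ^ (Q - 2) = x"
      using finite_field_power_card_eq_same[of x] unfolding Q_def[symmetric]
      by (metis mult.assoc power_Suc)
    hence "inverse x = x ^ (Q - 2)"
      using False by (simp add: field_simps)
    thus ?thesis unfolding z by (simp flip: of_int_power)
  qed
qed

definition divide_prime_field :: "'a prime_field \<Rightarrow> 'a prime_field \<Rightarrow> 'a prime_field" where
  "divide_prime_field x y = x * inverse y"

instance
  by standard (unfold divide_prime_field_def, (transfer, simp add: algebra_simps)+)

end

instantiation prime_field :: (finite_field)
  "{unique_euclidean_ring, normalization_euclidean_semiring, normalization_semidom_multiplicative}"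
begin

definition [simp]: "normalize_prime_field = (normalize_field :: 'a prime_field \<Rightarrow> _)"
definition [simp]: "unit_factor_prime_field = (unit_factor_field :: 'a prime_field \<Rightarrow> _)"
definition [simp]: "modulo_prime_field = (mod_field :: 'a prime_field \<Rightarrow> _)"
definition [simp]: "euclidean_size_prime_field = (euclidean_size_field :: 'a prime_field \<Rightarrow> _)"
definition [simp]: "division_segment (x :: 'a prime_field) = 1"

instance
  by standard (simp_all add: dvd_field_iff field_split_simps split: if_splits)

end

instantiation prime_field :: (finite_field) euclidean_ring_gcd
begin

definition gcd_prime_field :: "'a prime_field \<Rightarrow> 'a prime_field \<Rightarrow> 'a prime_field" where
  "gcd_prime_field = Euclidean_Algorithm.gcd"
definition lcm_prime_field :: "'a prime_field \<Rightarrow> 'a prime_field \<Rightarrow> 'a prime_field" where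
  "lcm_prime_field = Euclidean_Algorithm.lcm"
definition Gcd_prime_field :: "'a prime_field set \<Rightarrow> 'a prime_field" where
  "Gcd_prime_field = Euclidean_Algorithm.Gcd"
definition Lcm_prime_field :: "'a prime_field set \<Rightarrow> 'a prime_field" where
  "Lcm_prime_field = Euclidean_Algorithm.Lcm"

instance
  by standard
    (simp_all add: gcd_prime_field_def lcm_prime_field_def Gcd_prime_field_def Lcm_prime_field_def)

end

instance prime_field :: (finite_field) field_gcd ..

text \<open>Raising to the power \<open>m\<close> is additive and fixes 1, hence fixes every integer
  multiple of 1. This will make the action of polynomials linear over the prime field.\<close>

lemma Rep_prime_field_power_CHAR:
  assumes "m = CHAR('a :: finite_field) ^ e"
  shows   "Rep_prime_field (x :: 'a prime_field) ^ m = Rep_prime_field x"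
proof -
  have m: "m > 0" using assms by simp
  have add: "(u + v) ^ m = u ^ m + v ^ m" for u v :: 'a
    by (rule freshmans_dream'[OF _ assms]) simp
  have nat: "(of_nat k :: 'a) ^ m = of_nat k" for k
    by (induction k) (use m in \<open>simp_all add: add\<close>)
  have diff: "(u - v) ^ m = u ^ m - v ^ m" for u v :: 'a
    using add[of "u - v" v] by (simp add: algebra_simps)
  obtain z where "Rep_prime_field x = of_int z"
    using Rep_prime_field[of x] by auto
  moreover obtain a b where "z = int a - int b" by (cases z rule: int_diff_cases)
  ultimately show ?thesis by (simp add: diff nat)
qed

section \<open>Greatest common divisors of the polynomials \<open>x\<^sup>d - 1\<close>\<close>

abbreviation xpow_m1 :: "nat \<Rightarrow> 'a :: comm_ring_1 poly" where
  "xpow_m1 d \<equiv> monom 1 d - 1"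

lemma degree_xpow_m1:
  assumes "d > 0"
  shows   "degree (xpow_m1 d :: 'a :: comm_ring_1 poly) = d"
  using assms degree_add_eq_left[of "- 1" "monom (1 :: 'a) d"]
  by (simp add: degree_monom_eq)

lemma monom_1_neq_1 [simp]: "d > 0 \<Longrightarrow> monom 1 d \<noteq> (1 :: 'a :: comm_ring_1 poly)"
  using degree_xpow_m1[of d, where ?'a = 'a] by auto

lemma xpow_m1_mult:
  "xpow_m1 (d * m) = (xpow_m1 d :: 'a :: comm_ring_1 poly) * (\<Sum>i<m. monom 1 (d * i))"
proof -
  have "xpow_m1 (d * m) = (monom 1 d ^ m - 1 :: 'a poly)"
    by (simp add: monom_power)
  also have "\<dots> = xpow_m1 d * (\<Sum>i<m. monom 1 d ^ i)"
    by (rule power_diff_1_eq)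
  finally show ?thesis by (simp add: monom_power mult.commute)
qed

lemma xpow_m1_dvd: "d dvd e \<Longrightarrow> xpow_m1 d dvd (xpow_m1 e :: 'a :: comm_ring_1 poly)"
  by (auto simp: xpow_m1_mult)

text \<open>Euclid's algorithm on the exponents, by repeated subtraction:
  \<open>xpow_m1 v - monom 1 (v - u) * xpow_m1 u = xpow_m1 (v - u)\<close>.\<close>

lemma dvd_xpow_m1_gcd:
  fixes c :: "'a :: comm_ring_1 poly"
  shows "c dvd xpow_m1 a \<Longrightarrow> c dvd xpow_m1 b \<Longrightarrow> c dvd xpow_m1 (gcd a b)"
proof (induction "a + b" arbitrary: a b rule: less_induct)
  case less
  have step: "c dvd xpow_m1 (v - u)" if "c dvd xpow_m1 u" "c dvd xpow_m1 v" "u \<le> v" for u v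
  proof -
    have "xpow_m1 v - monom 1 (v - u) * xpow_m1 u = (xpow_m1 (v - u) :: 'a poly)"
      using that(3) by (simp add: algebra_simps mult_monom)
    with that(1,2) show ?thesis by (metis dvd_diff dvd_mult)
  qed
  consider "a = 0" | "b = 0" | "a > 0" "b > 0" "a \<le> b" | "a > 0" "b > 0" "b \<le> a" by linarith
  thus ?case
  proof cases
    case 3
    hence "c dvd xpow_m1 (gcd a (b - a))" using less step by simp
    with 3 show ?thesis using gcd_diff1_nat[of a b] by (simp add: gcd.commute)
  next
    case 4
    hence "c dvd xpow_m1 (gcd (a - b) b)" using less step by simp
    with 4 show ?thesis by (simp add: gcd_diff1_nat)
  qed (use less in simp_all)
qed

lemma normalize_xpow_m1:
  assumes "d > 0"
  shows   "normalize (xpow_m1 d) = (xpow_m1 d :: 'a :: field_gcd poly)"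
proof -
  have "lead_coeff (xpow_m1 d :: 'a poly) = 1"
    unfolding degree_xpow_m1[OF assms] using assms by simp
  thus ?thesis by (simp add: normalize_poly_eq_map_poly)
qed

lemma gcd_xpow_m1:
  assumes "a > 0"
  shows   "gcd (xpow_m1 a) (xpow_m1 b) = (xpow_m1 (gcd a b) :: 'a :: field_gcd poly)"
proof (rule sym, rule gcdI)
  show "normalize (xpow_m1 (gcd a b)) = (xpow_m1 (gcd a b) :: 'a poly)"
    using assms by (intro normalize_xpow_m1) simp
qed (auto intro: xpow_m1_dvd dvd_xpow_m1_gcd)

section \<open>The degree of the lcm by inclusion and exclusion\<close>

text \<open>On multiplicities of primes this is the distributivity of min over max.\<close>

lemma gcd_lcm_distrib:
  fixes a b c :: "'a :: factorial_ring_gcd"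
  assumes "a \<noteq> 0" "b \<noteq> 0" "c \<noteq> 0"
  shows   "gcd (lcm a b) c = lcm (gcd a c) (gcd b c)"
proof (rule associated_eqI)
  have nz: "lcm a b \<noteq> 0" "gcd a c \<noteq> 0" "gcd b c \<noteq> 0" using assms by (auto simp: lcm_eq_0_iff)
  have "prime_factorization (gcd (lcm a b) c) = prime_factorization (lcm (gcd a c) (gcd b c))"
    using assms nz
    by (simp add: prime_factorization_gcd prime_factorization_lcm multiset_eq_iff)
       (auto simp: min_def max_def)
  moreover have "gcd (lcm a b) c \<noteq> 0" "lcm (gcd a c) (gcd b c) \<noteq> 0"
    using assms nz by (auto simp: lcm_eq_0_iff)
  ultimately show "gcd (lcm a b) c dvd lcm (gcd a c) (gcd b c)"
    and "lcm (gcd a c) (gcd b c) dvd gcd (lcm a b) c"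
    by (metis prime_factorization_subset_iff_dvd subset_mset.order_refl)+
qed simp_all

lemma gcd_Lcm_distrib:
  fixes f :: "'i \<Rightarrow> 'a :: {factorial_ring_gcd, semiring_gcd_mult_normalize}"
  assumes "finite I" "c \<noteq> 0" "\<And>i. i \<in> I \<Longrightarrow> f i \<noteq> 0"
  shows   "gcd (Lcm (f ` I)) c = Lcm ((\<lambda>i. gcd (f i) c) ` I)"
  using assms
proof (induction I rule: finite_induct)
  case (insert j I)
  hence "Lcm (f ` I) \<noteq> 0" by (auto simp: Lcm_0_iff)
  with insert show ?case by (simp add: gcd_lcm_distrib)
qed simp

lemma degree_lcm:
  fixes f g :: "'a :: field_gcd poly"
  assumes "f \<noteq> 0" "g \<noteq> 0"
  shows   "degree (lcm f g) + degree (gcd f g) = degree f + degree g"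
proof -
  have nz: "lcm f g \<noteq> 0" "gcd f g \<noteq> 0" using assms by (auto simp: lcm_eq_0_iff)
  have "degree (lcm f g) + degree (gcd f g) = degree (lcm f g * gcd f g)"
    by (rule degree_mult_eq[OF nz, symmetric])
  also have "lcm f g * gcd f g = normalize f * normalize g" by (rule lcm_mult_gcd)
  also have "degree \<dots> = degree (normalize f) + degree (normalize g)"
    using assms by (intro degree_mult_eq) simp_all
  also have "\<dots> = degree f + degree g"
  proof -
    have "degree (normalize p) = degree p" for p :: "'a poly"
      by (cases "p = 0") (auto intro!: antisym dvd_imp_degree_le)
    thus ?thesis by simp
  qed
  finally show ?thesis .
qed

text \<open>This is \<open>lam\<close> over an arbitrary finite index set, so that an induction can
  add one index at a time.\<close>

definition incl_excl_gcd :: "'i set \<Rightarrow> ('i \<Rightarrow> nat) \<Rightarrow> int" where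
  "incl_excl_gcd I d = (\<Sum>S\<in>Pow I - {{}}. (-1) ^ (card S + 1) * int (Gcd (d ` S)))"

text \<open>A nonempty subset of \<open>insert j I\<close> avoids \<open>j\<close>, equals
  \<open>{j}\<close>, or adds \<open>j\<close> to a nonempty subset of \<open>I\<close>. The last
  kind has its sign flipped and its gcd taken with \<open>d j\<close>.\<close>

lemma incl_excl_gcd_insert:
  assumes "finite I" "j \<notin> I"
  shows   "incl_excl_gcd (insert j I) d =
             incl_excl_gcd I d + int (d j) - incl_excl_gcd I (\<lambda>i. gcd (d i) (d j))"
proof -
  define h where "h S = (-1) ^ (card S + 1) * int (Gcd (d ` S))" for S
  have inj: "inj_on (insert j) (Pow I)"
    using assms by (auto simp: inj_on_def)
  have "Pow (insert j I) - {{}} = (Pow I - {{}}) \<union> insert j ` Pow I"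
    by (auto simp: Pow_insert)
  moreover have "(Pow I - {{}}) \<inter> insert j ` Pow I = {}" using assms by auto
  ultimately have "incl_excl_gcd (insert j I) d = incl_excl_gcd I d + (\<Sum>S\<in>insert j ` Pow I. h S)"
    using assms unfolding incl_excl_gcd_def h_def by (simp add: sum.union_disjoint)
  also have "(\<Sum>S\<in>insert j ` Pow I. h S) = (\<Sum>S\<in>Pow I. h (insert j S))"
    using inj by (simp add: sum.reindex)
  also have "\<dots> = h {j} + (\<Sum>S\<in>Pow I - {{}}. h (insert j S))"
    using assms by (subst sum.remove[of _ "{}"]) auto
  also have "(\<Sum>S\<in>Pow I - {{}}. h (insert j S)) = - incl_excl_gcd I (\<lambda>i. gcd (d i) (d j))"
    unfolding incl_excl_gcd_def sum_negf[symmetric]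
  proof (rule sum.cong)
    fix S assume S: "S \<in> Pow I - {{}}"
    have fin: "finite S" and j: "j \<notin> S" using S assms finite_subset by auto
    \<comment> \<open>\<open>T\<close> has to be nonempty: for \<open>{}\<close> the left side is 0
      and the right side is \<open>d j\<close>.\<close>
    have "Gcd ((\<lambda>i. gcd (d i) (d j)) ` T) = gcd (d j) (Gcd (d ` T))" if "finite T" "T \<noteq> {}" for T
      using that by (induction T rule: finite_ne_induct) (simp_all add: ac_simps gcd.left_idem)
    with S fin have "Gcd ((\<lambda>i. gcd (d i) (d j)) ` S) = Gcd (d ` insert j S)" by simp
    with fin j show "h (insert j S) = - ((-1) ^ (card S + 1) * int (Gcd ((\<lambda>i. gcd (d i) (d j)) ` S)))"
      by (simp add: h_def)
  qed simp
  finally show ?thesis by (simp add: h_def)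
qed

text \<open>Degrees of lcms obey the recursion of \<open>incl_excl_gcd_insert\<close>: the gcd of
  the new polynomial with the old lcm is the lcm of the \<open>xpow_m1 (gcd (d i) (d j))\<close>.
  The induction therefore runs over all \<open>d\<close> at once.\<close>

lemma degree_Lcm_xpow_m1:
  assumes "finite I" "\<And>i. i \<in> I \<Longrightarrow> d i > 0"
  shows   "int (degree (Lcm ((\<lambda>i. xpow_m1 (d i)) ` I) :: 'a :: field_gcd poly)) = incl_excl_gcd I d"
  using assms
proof (induction I arbitrary: d rule: finite_induct)
  case empty
  thus ?case by (simp add: incl_excl_gcd_def)
next
  case (insert j I)
  define l where "l = (Lcm ((\<lambda>i. xpow_m1 (d i)) ` I) :: 'a poly)"
  define f where "f = (xpow_m1 (d j) :: 'a poly)"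
  have nz: "l \<noteq> 0" "f \<noteq> 0" using insert by (auto simp: l_def f_def Lcm_0_iff)
  have "gcd l f = Lcm ((\<lambda>i. gcd (xpow_m1 (d i)) f) ` I)"
    unfolding l_def using nz(2) insert by (intro gcd_Lcm_distrib) auto
  also have "(\<lambda>i. gcd (xpow_m1 (d i)) f) ` I = (\<lambda>i. xpow_m1 (gcd (d i) (d j))) ` I"
    unfolding f_def using insert.prems by (intro image_cong) (simp_all add: gcd_xpow_m1)
  finally have "int (degree (gcd l f)) = incl_excl_gcd I (\<lambda>i. gcd (d i) (d j))"
    using insert.IH[of "\<lambda>i. gcd (d i) (d j)"] insert.prems by simp
  moreover have "int (degree l) = incl_excl_gcd I d"
    unfolding l_def using insert by simp
  moreover have "degree f = d j" unfolding f_def using insert.prems by (simp add: degree_xpow_m1)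
  ultimately show ?case
    using degree_lcm[OF nz] insert.hyps
    by (simp add: incl_excl_gcd_insert l_def[symmetric] f_def[symmetric] lcm.commute)
qed

text \<open>The subsets are grouped by cardinality; the singletons give the first sum of
  \<open>lam\<close>.\<close>

lemma lam_eq_incl_excl_gcd: "lam k d = incl_excl_gcd {1..k} d"
proof -
  define h where "h S = (-1) ^ (card S + 1) * int (Gcd (d ` S))" for S
  have inner: "(\<Sum>L | L \<subseteq> {1..k} \<and> card L = i. h L) =
      (-1) ^ (i + 1) * (\<Sum>L | L \<subseteq> {1..k} \<and> card L = i. int (GCD l\<in>L. d l))" for i
    unfolding sum_distrib_left by (intro sum.cong) (auto simp: h_def)
  have "incl_excl_gcd {1..k} d = (\<Sum>S\<in>Pow {1..k} - {{}}. h S)"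
    by (simp add: incl_excl_gcd_def h_def)
  also have "\<dots> = (\<Sum>i\<in>{1..k}. \<Sum>S | S \<in> Pow {1..k} - {{}} \<and> card S = i. h S)"
  proof (rule sum.group[symmetric])
    show "card ` (Pow {1..k} - {{}}) \<subseteq> {1..k}"
    proof (rule image_subsetI)
      fix S assume "S \<in> Pow {1..k} - {{}}"
      moreover from this have "finite S" using finite_subset by blast
      ultimately show "card S \<in> {1..k}"
        using card_mono[of "{1..k}" S] by (auto simp: Suc_le_eq card_gt_0_iff)
    qed
  qed auto
  also have "\<dots> = (\<Sum>i\<in>{1..k}. \<Sum>L | L \<subseteq> {1..k} \<and> card L = i. h L)"
    by (intro sum.cong refl arg_cong[where f = "sum h"]) auto
  also have "\<dots> = lam k d"
  proof (cases "k = 0")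
    case False
    have "{L. L \<subseteq> {1..k} \<and> card L = 1} = (\<lambda>i. {i}) ` {1..k}"
      by (auto simp: card_1_singleton_iff)
    hence "(\<Sum>L | L \<subseteq> {1..k} \<and> card L = 1. h L) = (\<Sum>i=1..k. int (d i))"
      by (simp add: sum.reindex h_def)
    moreover have "(\<Sum>i\<in>{1..k}. g i) = g 1 + (\<Sum>i=2..k. g i)" for g :: "nat \<Rightarrow> int"
      using False by (simp add: sum.atLeast_Suc_atMost numeral_2_eq_2)
    ultimately show ?thesis unfolding lam_def inner[symmetric] by simp
  qed (simp add: lam_def)
  finally show ?thesis ..
qed

section \<open>The Frobenius action of polynomials\<close>

text \<open>By \<open>hom_mult\<close>, \<open>hom_fixed\<close> and \<open>frob_add\<close> the
  Frobenius map is linear over the coefficients, which is why products of polynomials act as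
  compositions in \<open>act_mult\<close>.\<close>

locale frobenius_module =
  fixes \<iota> :: "'k :: field_gcd \<Rightarrow> 'a :: finite_field" and q n :: nat
  assumes hom_1 [simp]: "\<iota> 1 = 1"
    and hom_add: "\<iota> (b + c) = \<iota> b + \<iota> c"
    and hom_mult: "\<iota> (b * c) = \<iota> b * \<iota> c"
    and hom_fixed: "\<iota> c ^ q = \<iota> c"
    and frob_add: "(x + y) ^ q = x ^ q + (y :: 'a) ^ q"
    and card_field: "card (UNIV :: 'a set) = q ^ n"
    and q_gt_1: "q > 1" and n_pos: "n > 0"
begin

lemma hom_0 [simp]: "\<iota> 0 = 0"
  using hom_add[of 0 0] by (metis add.right_neutral add_left_cancel)

lemma hom_eq_0_iff [simp]: "\<iota> c = 0 \<longleftrightarrow> c = 0"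
proof
  assume "\<iota> c = 0"
  hence "\<iota> (c * inverse c) = 0" by (simp add: hom_mult)
  thus "c = 0" by (cases "c = 0") simp_all
qed simp

lemma frob_sum: "(\<Sum>i\<in>S. g i :: 'a) ^ q = (\<Sum>i\<in>S. g i ^ q)"
  using q_gt_1 by (induction S rule: infinite_finite_induct) (simp_all add: frob_add)

text \<open>\<open>act f\<close> is evaluation of the linearized \<open>q\<close>-associate of
  \<open>f\<close>, in which the power \<open>q ^ i\<close> takes the place of the power
  \<open>i\<close>.\<close>

definition act :: "'k poly \<Rightarrow> 'a \<Rightarrow> 'a" where
  "act f x = (\<Sum>i\<le>degree f. \<iota> (coeff f i) * x ^ (q ^ i))"

lemma act_eq:
  assumes "degree f \<le> N"
  shows   "act f x = (\<Sum>i\<le>N. \<iota> (coeff f i) * x ^ (q ^ i))"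
  unfolding act_def using assms
  by (intro sum.mono_neutral_left) (auto simp: coeff_eq_0)

lemma act_0_left [simp]: "act 0 x = 0"
  by (simp add: act_def)

lemma act_add_left: "act (f + g) x = act f x + act g x"
  using act_eq[of f "max (degree f) (degree g)" x] act_eq[of g "max (degree f) (degree g)" x]
    act_eq[of "f + g" "max (degree f) (degree g)" x] degree_add_le_max[of f g]
  by (simp add: hom_add algebra_simps sum.distrib)

lemma act_diff_left: "act (f - g) x = act f x - act g x"
  using act_add_left[of "f - g" g x] by simp

lemma act_sum_left: "act (\<Sum>i\<in>S. g i) x = (\<Sum>i\<in>S. act (g i) x)"
  by (induction S rule: infinite_finite_induct) (simp_all add: act_add_left)

lemma act_smult: "act (smult c f) x = \<iota> c * act f x"
  using act_eq[of "smult c f" "degree f" x] degree_smult_le[of c f]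
  by (simp add: act_def hom_mult sum_distrib_left mult.assoc)

lemma act_pCons: "act (pCons c f) x = \<iota> c * x + act f x ^ q"
proof -
  have "act (pCons c f) x = (\<Sum>i\<le>Suc (degree f). \<iota> (coeff (pCons c f) i) * x ^ (q ^ i))"
    by (rule act_eq) (simp add: degree_pCons_le)
  also have "\<dots> = \<iota> c * x + (\<Sum>i\<le>degree f. \<iota> (coeff f i) * x ^ (q ^ Suc i))"
    by (subst sum.atMost_Suc_shift) simp
  also have "(\<Sum>i\<le>degree f. \<iota> (coeff f i) * x ^ (q ^ Suc i)) = act f x ^ q"
    by (simp add: act_def frob_sum power_mult_distrib hom_fixed mult.commute flip: power_mult)
  finally show ?thesis .
qed

lemma act_mult: "act (f * g) x = act f (act g x)"
  by (induction f) (simp_all add: act_add_left act_smult act_pCons)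

lemma act_monom: "act (monom 1 d) x = x ^ (q ^ d)"
proof (induction d)
  case 0
  thus ?case by (simp add: act_def)
next
  case (Suc d)
  thus ?case by (simp add: monom_Suc act_pCons mult.commute flip: power_mult)
qed

lemma act_1 [simp]: "act 1 x = x"
  using act_monom[of 0 x] by simp

lemma act_add: "act f (x + y) = act f x + act f y"
  by (induction f) (simp_all add: act_pCons frob_add algebra_simps)

lemma act_diff: "act f (x - y) = act f x - act f y"
  using act_add[of f "x - y" y] by simp

lemma act_zero [simp]: "act f 0 = 0"
  using act_add[of f 0 0] by (metis add.right_neutral add_left_cancel)

lemma act_xpow_m1: "act (xpow_m1 d) x = x ^ (q ^ d) - x"
  by (simp add: act_diff_left act_monom)

lemma act_xpow_m1_n [simp]: "act (xpow_m1 n) x = 0"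
  using finite_field_power_card_eq_same[of x] by (simp add: act_xpow_m1 card_field)

lemma act_eq_0_of_dvd: "xpow_m1 n dvd f \<Longrightarrow> act f x = 0"
  by (metis act_mult act_xpow_m1_n dvd_def mult.commute act_zero)

lemma act_trace_poly: "act (\<Sum>i<m div d. monom 1 (d * i)) x = tr q m d x"
  by (simp add: act_sum_left act_monom tr_def)

section \<open>Kernels and images of the action\<close>

text \<open>The kernel is the root set of the \<open>q\<close>-associate \<open>P\<close>. This is
  not the zero polynomial, because the exponents \<open>q ^ i\<close> are distinct and so the
  leading coefficient survives.\<close>

lemma card_kernel_le:
  assumes "f \<noteq> 0"
  shows   "card {x. act f x = 0} \<le> q ^ degree f"
proof -
  define P where "P = (\<Sum>i\<le>degree f. monom (\<iota> (coeff f i)) (q ^ i))"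
  have inj: "q ^ i = q ^ j \<longleftrightarrow> i = j" for i j using q_gt_1 by (simp add: power_inject_exp)
  have "coeff P (q ^ degree f) = \<iota> (lead_coeff f)"
    unfolding P_def by (simp add: coeff_sum coeff_monom inj if_distrib sum.delta cong: if_cong)
  with assms have "P \<noteq> 0" by auto
  moreover have "poly P x = act f x" for x
    by (simp add: P_def act_def poly_sum poly_monom)
  moreover have "degree P \<le> q ^ degree f"
    unfolding P_def
  proof (rule degree_sum_le)
    fix i assume "i \<in> {..degree f}"
    hence "q ^ i \<le> q ^ degree f" using q_gt_1 by (intro power_increasing) auto
    thus "degree (monom (\<iota> (coeff f i)) (q ^ i)) \<le> q ^ degree f"
      using degree_monom_le le_trans by blast
  qed simp
  ultimately show ?thesis using card_poly_roots_bound[of P] by simp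
qed

text \<open>All nonempty fibres of the additive map \<open>act f\<close> are translates of its
  kernel.\<close>

lemma card_field_le_kernel_range:
  "q ^ n \<le> card (range (act f)) * card {x. act f x = 0}"
proof -
  have fiber: "card {x. act f x = act f z} = card {x. act f x = 0}" for z
    by (rule bij_betw_same_card[of "\<lambda>x. x - z"], rule bij_betw_byWitness[of _ "\<lambda>x. x + z"])
       (auto simp: act_diff act_add)
  have "q ^ n = card (\<Union>y\<in>range (act f). {x. act f x = y})"
    unfolding card_field[symmetric] by (intro arg_cong[where f = card]) auto
  also have "\<dots> \<le> (\<Sum>y\<in>range (act f). card {x. act f x = y})"
    by (rule card_UN_le) simp
  also have "\<dots> = (\<Sum>y\<in>range (act f). card {x. act f x = 0})"
    by (intro sum.cong) (auto simp: fiber)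
  finally show ?thesis by simp
qed

text \<open>The image of \<open>g\<close> lies in the kernel of \<open>f\<close>. It has at least
  \<open>q ^ n / q ^ degree g = q ^ degree f\<close> elements, while the kernel of \<open>f\<close>
  has at most that many, so equality holds throughout.\<close>

lemma kernel_eq_range:
  assumes "f * g = xpow_m1 n"
  shows   "{x. act f x = 0} = range (act g)" and "card {x. act f x = 0} = q ^ degree f"
proof -
  have nz: "f \<noteq> 0" "g \<noteq> 0" using assms n_pos by auto
  have "degree (f * g) = n" unfolding assms by (rule degree_xpow_m1[OF n_pos])
  hence deg: "n = degree f + degree g" using nz by (simp add: degree_mult_eq)
  have sub: "range (act g) \<subseteq> {x. act f x = 0}"
    using assms by (auto simp flip: act_mult)
  have "q ^ degree f * q ^ degree g \<le> card (range (act g)) * card {x. act g x = 0}"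
    using card_field_le_kernel_range[of g] by (simp add: deg power_add)
  also have "\<dots> \<le> card (range (act g)) * q ^ degree g"
    using card_kernel_le[OF nz(2)] by simp
  finally have "q ^ degree f \<le> card (range (act g))"
    using q_gt_1 by simp
  with card_kernel_le[OF nz(1)] card_mono[OF _ sub]
  have "card {x. act f x = 0} = q ^ degree f" "card (range (act g)) = card {x. act f x = 0}"
    by auto
  thus "card {x. act f x = 0} = q ^ degree f" "{x. act f x = 0} = range (act g)"
    using card_subset_eq[OF _ sub] by auto
qed

text \<open>A nonzero annihilator of least degree divides all others, by division with remainder;
  \<open>xpow_m1 n\<close> shows that one exists.\<close>

lemma annihilator_principal:
  obtains w where "act w c = 0" "\<And>p. act p c = 0 \<Longrightarrow> w dvd p"
proof -
  define w where "w = arg_min degree (\<lambda>p. p \<noteq> 0 \<and> act p c = 0)"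
  have "xpow_m1 n \<noteq> 0 \<and> act (xpow_m1 n) c = 0" using n_pos by simp
  hence w: "w \<noteq> 0" "act w c = 0" "\<And>p. p \<noteq> 0 \<Longrightarrow> act p c = 0 \<Longrightarrow> degree w \<le> degree p"
    unfolding w_def
    using arg_min_natI[of "\<lambda>p. p \<noteq> 0 \<and> act p c = 0"] arg_min_nat_le[of "\<lambda>p. p \<noteq> 0 \<and> act p c = 0"]
    by blast+
  have "w dvd p" if "act p c = 0" for p
  proof (rule ccontr)
    assume "\<not> w dvd p"
    hence nz: "p mod w \<noteq> 0" by (simp add: dvd_eq_mod_eq_0)
    have "act (p mod w) c = act p c - act (p div w * w) c"
      by (simp flip: minus_div_mult_eq_mod add: act_diff_left)
    hence "act (p mod w) c = 0" using that w(2) by (simp add: act_mult)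
    with nz w(3) have "degree w \<le> degree (p mod w)" by blast
    with degree_mod_less[OF w(1), of p] nz show False by auto
  qed
  with w(2) that show thesis by blast
qed

text \<open>
  The trace equations form a Chinese remainder problem over \<open>K[x]\<close>, solved here one equation
  at a time. A defect \<open>c\<close> in the new equation is killed by \<open>f j\<close> divided by every \<open>gcd (f i) (f j)\<close>,
  hence by \<open>f j div G\<close> where \<open>G\<close> is the gcd of \<open>f j\<close> with the lcm \<open>l\<close> of the earlier \<open>f i\<close>. So \<open>c\<close>
  comes from an element of the image of \<open>G = u * l + v * f j\<close>, and its \<open>u * l\<close> part is a
  correction that does not disturb the earlier equations.
\<close>
lemma ex_common_solution:
  assumes "finite I"
    and "\<And>i. i \<in> I \<Longrightarrow> f i * h i = xpow_m1 n"
    and "\<And>i. i \<in> I \<Longrightarrow> act (f i) (a i) = 0"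
    and "\<And>i j. i \<in> I \<Longrightarrow> j \<in> I \<Longrightarrow> i \<noteq> j \<Longrightarrow>
           act (f i div gcd (f i) (f j)) (a i) = act (f j div gcd (f i) (f j)) (a j)"
  shows   "\<exists>\<alpha>. \<forall>i\<in>I. act (h i) \<alpha> = a i"
  using assms
proof (induction I rule: finite_induct)
  case (insert j I)
  note fh = insert.prems(1) and ker = insert.prems(2) and compat = insert.prems(3)
  obtain \<alpha> where \<alpha>: "\<And>i. i \<in> I \<Longrightarrow> act (h i) \<alpha> = a i"
    using insert.IH fh ker compat by blast
  have fnz: "f i \<noteq> 0" if "i \<in> insert j I" for i
    using fh[OF that] n_pos by auto
  define c where "c = a j - act (h j) \<alpha>"
  have "act (f j) c = 0"
    using ker[of j] fh[of j] by (simp add: c_def act_diff flip: act_mult)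
  then obtain \<gamma> where \<gamma>: "act (h j) \<gamma> = c"
    using kernel_eq_range(1)[of "f j" "h j"] fh[of j] by force
  obtain w where w: "act w c = 0" "\<And>p. act p c = 0 \<Longrightarrow> w dvd p"
    using annihilator_principal[where c = c] by metis
  then obtain r where r: "f j = w * r" using \<open>act (f j) c = 0\<close> by blast
  have wnz: "w \<noteq> 0" using r fnz[of j] by auto
  have "gcd (f i) (f j) dvd r" if i: "i \<in> I" for i
  proof -
    define g where "g = gcd (f i) (f j)"
    obtain s t where st: "f i = g * s" "f j = g * t" unfolding g_def by (meson dvd_def gcd_dvd1 gcd_dvd2)
    have gnz: "g \<noteq> 0" using st fnz[of j] by auto
    have ij: "i \<noteq> j" using i insert.hyps by auto
    have "g * (t * h j) = g * (s * h i)"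
      using fh[of i] fh[of j] i st by (metis insertCI mult.assoc)
    hence eq: "t * h j = s * h i" using gnz by simp
    have "act t (a j) = act s (a i)"
      using compat[of i j] i ij gnz unfolding g_def[symmetric] by (simp add: st)
    hence "act t c = act s (a i) - act (t * h j) \<alpha>"
      by (simp add: c_def act_diff act_mult)
    also have "\<dots> = 0" by (simp add: eq act_mult \<alpha> i)
    finally have "w dvd t" by (rule w(2))
    then obtain t' where "t = w * t'" by blast
    hence "w * r = w * (g * t')" using r st by (auto simp: mult_ac)
    thus ?thesis using wnz by (simp add: g_def)
  qed
  hence "Lcm ((\<lambda>i. gcd (f i) (f j)) ` I) dvd r" by (intro Lcm_least) auto
  moreover define l where "l = Lcm (f ` I)"
  moreover define G where "G = gcd l (f j)"
  ultimately have "G dvd r"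
    using gcd_Lcm_distrib[of I "f j" f] insert.hyps fnz by auto
  then obtain e where e: "r = G * e" by blast
  \<comment> \<open>As \<open>f j = w * G * e\<close>, the polynomial \<open>w * e * h j\<close> is
    the cofactor of \<open>G\<close> in \<open>xpow_m1 n\<close>, so its kernel is the image of
    \<open>G\<close>.\<close>
  have "act (w * e * h j) \<gamma> = 0"
    using w(1) by (simp add: act_mult \<gamma> mult.commute[of w e])
  moreover have "(w * e * h j) * G = xpow_m1 n"
    using fh[of j] by (simp add: r e mult_ac)
  ultimately obtain \<delta> where \<delta>: "\<gamma> = act G \<delta>"
    using kernel_eq_range(1) by blast
  obtain u v where uv: "G = u * l + v * f j"
    unfolding G_def using bezout_coefficients_fst_snd[of l "f j"] by metis
  define y where "y = act (u * l) \<delta>"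
  have "act (h j) y = c"
  proof -
    have "y = \<gamma> - act (v * f j) \<delta>" by (simp add: y_def \<delta> uv act_add_left)
    hence "act (h j) y = c - act (h j * (v * f j)) \<delta>" by (simp add: act_diff \<gamma> act_mult)
    moreover have "xpow_m1 n dvd h j * (v * f j)"
      using fh[of j] by (metis dvd_triv_left insertI1 mult.assoc mult.commute)
    ultimately show ?thesis by (simp add: act_eq_0_of_dvd)
  qed
  moreover have "act (h i) y = 0" if i: "i \<in> I" for i
  proof -
    have "f i dvd l" unfolding l_def using i by (intro dvd_Lcm) auto
    then obtain s where "l = f i * s" by blast
    hence "h i * (u * l) = (f i * h i) * (u * s)" by (simp add: mult_ac)
    moreover have "f i * h i = xpow_m1 n" using fh i by blast
    ultimately have "xpow_m1 n dvd h i * (u * l)" by (metis dvd_triv_left)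
    thus ?thesis unfolding y_def by (simp add: act_eq_0_of_dvd flip: act_mult)
  qed
  ultimately have "\<forall>i\<in>insert j I. act (h i) (\<alpha> + y) = a i"
    using \<alpha> by (auto simp: act_add c_def)
  thus ?case by blast
qed simp

text \<open>The lcm \<open>l\<close> divides \<open>xpow_m1 n\<close>, and its cofactor
  \<open>m\<close> divides every \<open>h i\<close>. So the kernel of \<open>m\<close>, of size
  \<open>q ^ (n - degree l)\<close>, lies in the common kernel.\<close>

lemma card_common_kernel_ge:
  assumes "\<And>i. i \<in> I \<Longrightarrow> f i * h i = xpow_m1 n"
  shows   "q ^ n \<le> q ^ degree (Lcm (f ` I)) * card {x. \<forall>i\<in>I. act (h i) x = 0}"
proof -
  define l where "l = Lcm (f ` I)"
  have "l dvd xpow_m1 n"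
    unfolding l_def
  proof (rule Lcm_least)
    fix g assume "g \<in> f ` I"
    with assms show "g dvd xpow_m1 n" by (metis dvd_triv_left imageE)
  qed
  then obtain m where m: "l * m = xpow_m1 n" by (metis dvd_def)
  have nz: "l \<noteq> 0" "m \<noteq> 0" using m n_pos by auto
  have "degree (l * m) = n" unfolding m by (rule degree_xpow_m1[OF n_pos])
  hence deg: "n = degree l + degree m" using nz by (simp add: degree_mult_eq)
  have "{x. act m x = 0} \<subseteq> {x. \<forall>i\<in>I. act (h i) x = 0}"
  proof safe
    fix x i assume x: "act m x = 0" and i: "i \<in> I"
    have "f i dvd l" unfolding l_def using i by (intro dvd_Lcm) auto
    then obtain s where s: "l = f i * s" by blast
    have "f i * h i = f i * (s * m)" using m assms[OF i] s by (simp add: mult_ac)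
    moreover have "f i \<noteq> 0" using s nz by auto
    ultimately have "h i = s * m" by simp
    thus "act (h i) x = 0" by (simp add: act_mult x)
  qed
  hence "card {x. act m x = 0} \<le> card {x. \<forall>i\<in>I. act (h i) x = 0}"
    by (intro card_mono) auto
  moreover have "card {x. act m x = 0} = q ^ degree m"
    using kernel_eq_range(2)[of m l] m by (simp add: mult.commute)
  ultimately show ?thesis by (simp add: deg power_add l_def[symmetric])
qed

end

section \<open>Multiplicative characters and primitive elements\<close>

text \<open>Since \<open>\<chi> 0 = 0\<close> also for the trivial character, nontriviality is
  expressed below by a nonzero \<open>y\<close> with \<open>\<chi> y \<noteq> 1\<close>.\<close>

definition mult_character :: "('a :: finite_field \<Rightarrow> complex) \<Rightarrow> bool" where
  "mult_character \<chi> \<longleftrightarrow>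
     (\<forall>x y. \<chi> (x * y) = \<chi> x * \<chi> y) \<and> \<chi> 0 = 0 \<and> (\<forall>x. x \<noteq> 0 \<longrightarrow> norm (\<chi> x) = 1)"

lemma mult_character_sum:
  fixes \<chi> :: "'a :: finite_field \<Rightarrow> complex"
  assumes "mult_character \<chi>" "y \<noteq> 0" "\<chi> y \<noteq> 1"
  shows   "(\<Sum>x\<in>UNIV. \<chi> x) = 0"
proof -
  have "(\<Sum>x\<in>UNIV. \<chi> x) = (\<Sum>x\<in>UNIV. \<chi> (y * x))"
    by (rule sum.reindex_bij_witness[of _ "\<lambda>x. y * x" "\<lambda>x. x / y"]) (use assms(2) in auto)
  also have "\<dots> = \<chi> y * (\<Sum>x\<in>UNIV. \<chi> x)"
    using assms(1) by (simp add: mult_character_def sum_distrib_left)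
  finally show ?thesis using assms(3) by simp
qed

text \<open>Multiplicativity turns the term at \<open>c \<noteq> 0\<close> into
  \<open>\<chi> (1 + t / c)\<close>. The argument takes every value except 1 exactly once, so the
  full character sum, which is 0, only lacks \<open>\<chi> 1 = 1\<close>.\<close>

lemma mult_character_shift_correlation:
  fixes \<chi> :: "'a :: finite_field \<Rightarrow> complex"
  assumes "mult_character \<chi>" "y \<noteq> 0" "\<chi> y \<noteq> 1" "t \<noteq> 0"
  shows   "(\<Sum>c\<in>UNIV. \<chi> (c + t) * cnj (\<chi> c)) = -1"
proof -
  have mult: "\<chi> (u * v) = \<chi> u * \<chi> v" for u v using assms(1) by (simp add: mult_character_def)
  have zero: "\<chi> 0 = 0" using assms(1) by (simp add: mult_character_def)
  have unit: "\<chi> c * cnj (\<chi> c) = 1" if "c \<noteq> 0" for c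
    using assms(1) that by (simp add: mult_character_def complex_norm_square[symmetric])
  have one: "\<chi> 1 = 1"
  proof -
    have "\<chi> 1 \<noteq> 0" using unit[of 1] by auto
    thus ?thesis using mult[of 1 1] by simp
  qed
  have "(\<Sum>c\<in>UNIV. \<chi> (c + t) * cnj (\<chi> c)) = (\<Sum>c\<in>UNIV-{0}. \<chi> (c + t) * cnj (\<chi> c))"
    by (intro sum.mono_neutral_right) (auto simp: zero)
  also have "\<dots> = (\<Sum>c\<in>UNIV-{0}. \<chi> (1 + t / c))"
  proof (rule sum.cong)
    fix c :: 'a assume "c \<in> UNIV - {0}"
    hence c: "c \<noteq> 0" by simp
    hence "c + t = (1 + t / c) * c" by (simp add: field_simps)
    hence "\<chi> (c + t) * cnj (\<chi> c) = \<chi> (1 + t / c) * (\<chi> c * cnj (\<chi> c))"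
      by (metis mult mult.assoc)
    thus "\<chi> (c + t) * cnj (\<chi> c) = \<chi> (1 + t / c)" by (simp add: unit c)
  qed simp
  also have "\<dots> = (\<Sum>x\<in>UNIV-{1}. \<chi> x)"
    by (rule sum.reindex_bij_witness[of _ "\<lambda>x. t / (x - 1)" "\<lambda>c. 1 + t / c"]) (use assms(4) in auto)
  also have "\<dots> = -1"
    using mult_character_sum[OF assms(1-3)] by (simp add: sum_diff1 one)
  finally show ?thesis .
qed

text \<open>
  Averaging the square of the sum over all translates replaces the usual detour through Gauss
  sums: the second moment over \<open>c\<close> of the sum of \<open>\<chi>\<close> on \<open>c + K\<close> is exactly \<open>|K| (Q - |K|)\<close>,
  and the coset in question contributes \<open>|K|\<close> equal terms to it.
\<close>
lemma mult_character_coset_sum: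
  fixes \<chi> :: "'a :: finite_field \<Rightarrow> complex"
  assumes "mult_character \<chi>" "y \<noteq> 0" "\<chi> y \<noteq> 1"
    and K: "0 \<in> K" "\<And>u v. u \<in> K \<Longrightarrow> v \<in> K \<Longrightarrow> u - v \<in> K"
  shows   "norm (\<Sum>k\<in>K. \<chi> (\<beta> + k)) \<le> sqrt (real (card (UNIV :: 'a set)))"
proof -
  define Q where "Q = card (UNIV :: 'a set)"
  define s where "s c = (\<Sum>k\<in>K. \<chi> (c + k))" for c
  have Kneg: "- u \<in> K" if "u \<in> K" for u using K(1) K(2)[of 0 u] that by simp
  have Kadd: "u + v \<in> K" if "u \<in> K" "v \<in> K" for u v
    using K(2)[of u "- v"] Kneg[of v] that by simp
  have shift: "s (\<beta> + k) = s \<beta>" if "k \<in> K" for k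
    unfolding s_def
    by (rule sum.reindex_bij_witness[of _ "\<lambda>u. u - k" "\<lambda>u. u + k"])
       (use that K(2) Kadd in \<open>auto simp: algebra_simps\<close>)
  have corr: "(\<Sum>c\<in>UNIV. \<chi> (c + u) * cnj (\<chi> (c + v))) = (if u = v then of_nat Q else 0) - 1" for u v
  proof -
    have "(\<Sum>c\<in>UNIV. \<chi> (c + u) * cnj (\<chi> (c + v))) = (\<Sum>c\<in>UNIV. \<chi> (c + (u - v)) * cnj (\<chi> c))"
      by (rule sum.reindex_bij_witness[of _ "\<lambda>c. c - v" "\<lambda>c. c + v"]) (auto simp: algebra_simps)
    also have "\<dots> = (if u = v then of_nat Q else 0) - 1"
    proof (cases "u = v")
      case True
      have "\<chi> c * cnj (\<chi> c) = (if c = 0 then 0 else 1)" for c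
        using assms(1) by (simp add: mult_character_def complex_norm_square[symmetric])
      hence "(\<Sum>c\<in>UNIV. \<chi> c * cnj (\<chi> c)) = (\<Sum>c\<in>UNIV-{0::'a}. 1)"
        by (intro sum.mono_neutral_cong_right) auto
      also have "\<dots> = of_nat Q - 1"
        by (simp add: Q_def of_nat_diff Suc_le_eq finite_UNIV_card_ge_0)
      finally show ?thesis using True by simp
    next
      case False
      thus ?thesis using mult_character_shift_correlation[OF assms(1-3), of "u - v"] by simp
    qed
    finally show ?thesis .
  qed
  have "(\<Sum>c\<in>UNIV. complex_of_real ((norm (s c))\<^sup>2)) =
        (\<Sum>c\<in>UNIV. \<Sum>u\<in>K. \<Sum>v\<in>K. \<chi> (c + u) * cnj (\<chi> (c + v)))"
    by (simp only: complex_norm_square s_def sum_product cnj_sum)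
  also have "\<dots> = (\<Sum>u\<in>K. \<Sum>c\<in>UNIV. \<Sum>v\<in>K. \<chi> (c + u) * cnj (\<chi> (c + v)))"
    by (rule sum.swap)
  also have "\<dots> = (\<Sum>u\<in>K. \<Sum>v\<in>K. \<Sum>c\<in>UNIV. \<chi> (c + u) * cnj (\<chi> (c + v)))"
    by (intro sum.cong refl sum.swap)
  also have "\<dots> = of_nat (card K) * (of_nat Q - of_nat (card K))"
    by (simp add: corr sum_subtractf sum.delta)
  finally have "complex_of_real (\<Sum>c\<in>UNIV. (norm (s c))\<^sup>2) =
      complex_of_real (real (card K) * (real Q - real (card K)))" by simp
  hence total: "(\<Sum>c\<in>UNIV. (norm (s c))\<^sup>2) = real (card K) * (real Q - real (card K))"
    by (simp only: of_real_eq_iff)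
  have cpos: "card K > 0" using K(1) by (auto simp: card_gt_0_iff)
  have "real (card K) * (norm (s \<beta>))\<^sup>2 = (\<Sum>c\<in>(+) \<beta> ` K. (norm (s c))\<^sup>2)"
    by (simp add: sum.reindex shift)
  also have "\<dots> \<le> (\<Sum>c\<in>UNIV. (norm (s c))\<^sup>2)" by (intro sum_mono2) auto
  also have "\<dots> \<le> real (card K) * real Q" by (simp add: total mult_left_mono)
  finally have "(norm (s \<beta>))\<^sup>2 \<le> real Q" using cpos by simp
  thus ?thesis unfolding s_def Q_def by (rule real_le_rsqrt)
qed

section \<open>Generators of the multiplicative group\<close>

lemma finite_field_ex_generator:
  obtains g :: "'a :: finite_field" where "g \<noteq> 0" "\<And>x. x \<noteq> 0 \<Longrightarrow> \<exists>i. x = g ^ i"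
proof -
  \<comment> \<open>A record copy of the field, to which the cyclicity theorem for multiplicative
    groups of finite fields applies.\<close>
  define R :: "'a ring" where "R = \<lparr>carrier = UNIV, mult = (*), one = 1, zero = 0, add = (+)\<rparr>"
  have "\<exists>y. y + x = 0" for x :: 'a by (rule exI[of _ "- x"]) simp
  moreover have "\<exists>y. y * x = 1" if "x \<noteq> 0" for x :: 'a
    using that by (intro exI[of _ "inverse x"]) simp
  ultimately interpret R: field R
    unfolding R_def by unfold_locales (auto simp: Units_def algebra_simps)
  have pow: "x [^]\<^bsub>R\<^esub> i = x ^ i" for x :: 'a and i :: nat
    by (induction i) (simp_all add: R_def mult.commute)
  have carrier: "carrier (mult_of R) = UNIV - {0}"
    by (simp add: carrier_mult_of R_def)
  have fin: "finite (carrier R)" by (simp add: R_def)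
  obtain g where g: "g \<in> carrier (mult_of R)"
    "carrier (mult_of R) = {g [^]\<^bsub>R\<^esub> i | i::nat. i \<in> UNIV}"
    using R.finite_field_mult_group_has_gen[OF fin] by (elim bexE)
  have "g \<noteq> 0" using g(1) unfolding carrier by simp
  moreover have "\<exists>i. x = g ^ i" if "x \<noteq> 0" for x
  proof -
    have "x \<in> {g [^]\<^bsub>R\<^esub> i | i::nat. i \<in> UNIV}"
      using that unfolding g(2)[symmetric] carrier by simp
    then obtain i :: nat where "x = g [^]\<^bsub>R\<^esub> i" by blast
    thus ?thesis unfolding pow ..
  qed
  ultimately show thesis by (rule that)
qed

text \<open>With \<open>N\<close> nonzero elements, \<open>g ^ N = 1\<close>, so the powers with
  exponents below \<open>N\<close> already exhaust these elements and are therefore pairwise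
  distinct.\<close>

lemma generator_power_eq_iff:
  fixes g :: "'a :: finite_field"
  assumes "g \<noteq> 0" "\<And>x. x \<noteq> 0 \<Longrightarrow> \<exists>i. x = g ^ i"
  shows   "g ^ i = g ^ j \<longleftrightarrow> [i = j] (mod (card (UNIV :: 'a set) - 1))"
proof -
  define N where "N = card (UNIV :: 'a set) - 1"
  have "card {0, 1 :: 'a} \<le> card (UNIV :: 'a set)" by (rule card_mono) auto
  hence N: "N > 0" "card (UNIV :: 'a set) = Suc N" by (simp_all add: N_def)
  have "g * g ^ N = g" using finite_field_power_card_eq_same[of g] N(2) by simp
  hence gN: "g ^ N = 1" using assms(1) by simp
  have red: "g ^ i = g ^ (i mod N)" for i
    by (metis gN mod_mult_div_eq mult.right_neutral power_add power_mult power_one)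
  have "UNIV - {0} \<subseteq> (\<lambda>i. g ^ i) ` {..<N}"
  proof
    fix x :: 'a assume "x \<in> UNIV - {0}"
    then obtain i where "x = g ^ i" using assms(2) by blast
    thus "x \<in> (\<lambda>i. g ^ i) ` {..<N}" using red[of i] N(1) by auto
  qed
  moreover have "(\<lambda>i. g ^ i) ` {..<N} \<subseteq> UNIV - {0}" using assms(1) by auto
  ultimately have "(\<lambda>i. g ^ i) ` {..<N} = UNIV - {0}" by blast
  hence "card ((\<lambda>i. g ^ i) ` {..<N}) = card {..<N}" by (simp add: N(2))
  hence "inj_on (\<lambda>i. g ^ i) {..<N}" by (simp add: eq_card_imp_inj_on)
  hence "g ^ (i mod N) = g ^ (j mod N) \<longleftrightarrow> i mod N = j mod N"
    using N(1) by (auto simp: inj_on_def)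
  thus ?thesis using red[of i] red[of j] by (simp add: cong_def N_def)
qed

text \<open>An inverse \<open>j\<close> of \<open>i\<close> modulo the group order exhibits
  \<open>g\<close> itself as a power of \<open>g ^ i\<close>.\<close>

lemma primitive_element_generator_power:
  fixes g :: "'a :: finite_field"
  assumes g: "g \<noteq> 0" "\<And>x. x \<noteq> 0 \<Longrightarrow> \<exists>i. x = g ^ i"
    and "coprime i (card (UNIV :: 'a set) - 1)"
  shows   "primitive_element (g ^ i)"
proof -
  obtain j where "[i * j = 1] (mod (card (UNIV :: 'a set) - 1))"
    using cong_solve_coprime_nat[OF assms(3)] by auto
  hence j: "g ^ (i * j) = g"
    using generator_power_eq_iff[OF g, of "i * j" 1] by simp
  have "\<exists>m::int. x = (g ^ i) powi m" if "x \<noteq> 0" for x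
  proof -
    obtain l where "x = g ^ l" using g(2)[OF \<open>x \<noteq> 0\<close>] by blast
    moreover have "(g ^ i) ^ (j * l) = (g ^ (i * j)) ^ l"
      by (simp add: mult.assoc flip: power_mult)
    ultimately have "x = (g ^ i) powi int (j * l)" by (simp only: j power_int_of_nat)
    thus ?thesis ..
  qed
  moreover have "(g ^ i) powi m \<noteq> 0" for m :: int using g(1) by simp
  ultimately show ?thesis
    unfolding primitive_element_def by (intro equalityI subsetI) (auto simp: image_iff)
qed

text \<open>A set of prime divisors is recovered from its product, which is a squarefree divisor.
  This bounds the number of terms in the expansion over sets of primes.\<close>

lemma W_ge:
  assumes "N > 0"
  shows   "2 ^ card (prime_factors N) \<le> W N"
proof -
  have fin: "finite {m. m dvd N \<and> squarefree m}" using assms by simp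
  have pf: "prime_factors (\<Prod>S) = S" if "S \<subseteq> prime_factors N" for S
  proof -
    have "finite S" using that finite_subset by blast
    moreover have "prime p" if "p \<in> S" for p using \<open>S \<subseteq> _\<close> that by auto
    ultimately show ?thesis
      by (subst prime_factors_prod) (force simp: prime_prime_factors)+
  qed
  hence "inj_on \<Prod> (Pow (prime_factors N))"
    by (intro inj_onI) (metis PowD)
  moreover have "\<Prod> ` Pow (prime_factors N) \<subseteq> {m. m dvd N \<and> squarefree m}"
  proof safe
    fix S assume S: "S \<subseteq> prime_factors N"
    hence fin: "finite S" and prime: "\<And>p. p \<in> S \<Longrightarrow> prime p" using finite_subset by auto
    show "squarefree (\<Prod>S)"
      using fin prime
      by (intro squarefree_prod_coprime) (auto simp: squarefree_prime primes_coprime)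
    have "\<Prod>S dvd \<Prod>(prime_factors N)" using S by (intro prod_dvd_prod_subset) auto
    also have "\<Prod>(prime_factors N) dvd (\<Prod>p\<in>prime_factors N. p ^ multiplicity p N)"
      by (intro prod_dvd_prod dvd_power) (auto simp: prime_factors_multiplicity)
    also have "\<dots> = N" using assms by (simp add: prime_factorization_nat[symmetric])
    finally show "\<Prod>S dvd N" .
  qed
  ultimately have "card (Pow (prime_factors N)) \<le> W N"
    unfolding W_def using fin by (metis card_image card_mono)
  thus ?thesis by (simp add: card_Pow)
qed

section \<open>Primitive elements in cosets of additive subgroups\<close>

lemma ex_primitive_element_in_coset:
  fixes \<beta> :: "'a :: finite_field"
  defines "Q \<equiv> card (UNIV :: 'a set)"
  assumes K: "0 \<in> K" "\<And>u v. u \<in> K \<Longrightarrow> v \<in> K \<Longrightarrow> u - v \<in> K"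
    and large: "real (W (Q - 1)) * sqrt (real Q) \<le> real (card K)"
  shows   "\<exists>k\<in>K. primitive_element (\<beta> + k)"
proof (rule ccontr)
  assume none: "\<not> ?thesis"
  define N where "N = Q - 1"
  have "card {0, 1 :: 'a} \<le> Q" unfolding Q_def by (rule card_mono) auto
  hence Q: "Q \<ge> 2" and N: "N > 0" by (simp_all add: N_def)
  obtain g :: 'a where g: "g \<noteq> 0" "\<And>x. x \<noteq> 0 \<Longrightarrow> \<exists>i. x = g ^ i"
    using finite_field_ex_generator[where ?'a = 'a] by metis
  \<comment> \<open>The discrete logarithm to base \<open>g\<close>: determined modulo
    \<open>N\<close> at nonzero \<open>x\<close>, and arbitrary at 0.\<close>
  define ind where "ind x = (SOME i. x = g ^ i)" for x
  have ind: "x = g ^ ind x" if "x \<noteq> 0" for x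
    unfolding ind_def using g(2)[OF that] by (rule someI_ex)
  have ind_cong: "[ind (g ^ i) = i] (mod N)" for i
    using ind[of "g ^ i"] g generator_power_eq_iff[OF g, of "ind (g ^ i)" i] by (simp add: N_def Q_def)
  have ind_mult: "[ind (x * y) = ind x + ind y] (mod N)" if "x \<noteq> 0" "y \<noteq> 0" for x y
    using ind_cong[of "ind x + ind y"] ind that by (metis power_add)
  define P where "P = prime_factors N"
  have P: "finite P" "\<And>p. p \<in> P \<Longrightarrow> prime p" "\<And>p. p \<in> P \<Longrightarrow> p dvd N" by (auto simp: P_def)
  have Ppos: "p > 0" "p > 1" if "p \<in> P" for p using P(2)[OF that] prime_gt_0_nat prime_gt_1_nat by auto

  \<comment> \<open>A \<open>p\<close>-th root of unity, depending on \<open>i\<close> only modulo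
    \<open>p\<close>. For \<open>p\<close> dividing \<open>N\<close> it is thus well defined on
    discrete logarithms.\<close>
  define e where "e p i = cis (2 * pi * real i / real p)" for p i :: nat
  have e_add: "e p (i + j) = e p i * e p j" for p i j
    by (simp add: e_def cis_mult add_divide_distrib distrib_left)
  have e_dvd: "e p i = 1" if "p dvd i" "p > 0" for p i
  proof -
    obtain m where "i = p * m" using \<open>p dvd i\<close> by blast
    hence "2 * pi * real i / real p = 2 * pi * real m" using that(2) by (simp add: field_simps)
    moreover have "real m \<in> \<int>" by (rule Ints_of_nat)
    ultimately show ?thesis unfolding e_def by (simp only: cis_multiple_2pi)
  qed
  have e_cong: "e p i = e p j" if "[i = j] (mod N)" "p \<in> P" for p i j
  proof -
    have "e p i = e p (i mod p)" for i
      using e_add[of p "i mod p" "p * (i div p)"] e_dvd[of p "p * (i div p)"] Ppos[OF that(2)] by simp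
    moreover have "i mod p = j mod p"
      using that P(3) cong_dvd_modulus_nat unfolding cong_def by blast
    ultimately show ?thesis by metis
  qed
  have e_neq_1: "e p i \<noteq> 1" if "\<not> p dvd i" "p > 0" for p i
  proof
    assume "e p i = 1"
    hence "cos (2 * pi * real i / real p) = 1"
      unfolding e_def by (metis cis.simps(1) one_complex.simps(1))
    then obtain m :: int where "2 * pi * real i / real p = of_int m * 2 * pi"
      unfolding cos_one_2pi_int by blast
    hence "real i = of_int m * real p" using that(2) by (simp add: field_simps)
    hence "int i = m * int p" by (metis of_int_eq_iff of_int_mult of_int_of_nat_eq)
    hence "int p dvd int i" by simp
    with that(1) show False by (simp only: int_dvd_int_iff)
  qed

  \<comment> \<open>The product over \<open>p\<close> in \<open>S\<close> of the
    \<open>r p\<close>-th power of a character of order \<open>p\<close>.\<close>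
  define \<chi> where "\<chi> S r x = (if x = 0 then 0 else \<Prod>p\<in>S. e p (r p * ind x))" for S r x
  have char: "mult_character (\<chi> S r)" if "S \<subseteq> P" for S r
  proof -
    have "\<chi> S r (x * y) = \<chi> S r x * \<chi> S r y" for x y
    proof (cases "x = 0 \<or> y = 0")
      case False
      have "e p (r p * ind (x * y)) = e p (r p * ind x) * e p (r p * ind y)" if "p \<in> S" for p
      proof -
        have "[r p * ind (x * y) = r p * (ind x + ind y)] (mod N)"
          using ind_mult[of x y] False by (intro cong_scalar_left) auto
        thus ?thesis using e_cong \<open>S \<subseteq> P\<close> that by (metis distrib_left e_add subsetD)
      qed
      thus ?thesis using False by (simp add: \<chi>_def prod.distrib)
    qed (auto simp: \<chi>_def)
    thus ?thesis by (simp add: mult_character_def \<chi>_def e_def prod_norm[symmetric])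
  qed
  have nontriv: "\<exists>y. y \<noteq> 0 \<and> \<chi> S r y \<noteq> 1"
    if S: "S \<subseteq> P" "S \<noteq> {}" and r: "\<And>p. p \<in> S \<Longrightarrow> r p \<in> {1..<p}" for S r
  proof -
    obtain p where p: "p \<in> S" using S by blast
    \<comment> \<open>The product of the other primes in \<open>S\<close>: the exponent
      \<open>M\<close> makes their factors 1 but leaves the factor at \<open>p\<close>
      nontrivial.\<close>
    define M where "M = \<Prod>(S - {p})"
    have fin: "finite S" using S P(1) finite_subset by blast
    have "e s (r s * ind (g ^ M)) = e s (r s * M)" if "s \<in> S" for s
      using that S ind_cong[of M] by (intro e_cong cong_scalar_left) auto
    hence "\<chi> S r (g ^ M) = (\<Prod>s\<in>S. e s (r s * M))" using g(1) by (simp add: \<chi>_def)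
    also have "\<dots> = e p (r p * M) * (\<Prod>s\<in>S-{p}. e s (r s * M))"
      using fin p by (rule prod.remove)
    also have "(\<Prod>s\<in>S-{p}. e s (r s * M)) = 1"
    proof (intro prod.neutral ballI)
      fix s assume s: "s \<in> S - {p}"
      hence "s dvd M" unfolding M_def using fin by (intro dvd_prodI) auto
      thus "e s (r s * M) = 1" using s S Ppos by (intro e_dvd) auto
    qed
    finally have "\<chi> S r (g ^ M) = e p (r p * M)" by simp
    moreover have "\<not> p dvd r p * M"
    proof -
      have prime: "prime p" using p S P by blast
      have "\<not> p dvd r p" using r[OF p] by (auto dest: dvd_imp_le)
      moreover have "\<not> p dvd M"
      proof
        assume "p dvd M"
        then obtain s where s: "s \<in> S - {p}" "p dvd s"
          unfolding M_def using prime_dvd_prod_iff[of "S - {p}" p "\<lambda>x. x"] prime fin by auto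
        thus False using primes_dvd_imp_eq[of p s] prime P S by blast
      qed
      ultimately show ?thesis using prime by (simp add: prime_dvd_mult_iff)
    qed
    ultimately have "\<chi> S r (g ^ M) \<noteq> 1" using e_neq_1 Ppos p S by auto
    thus ?thesis using g(1) by (intro exI[of _ "g ^ M"]) auto
  qed

  define R where "R S = PiE S (\<lambda>p. {1..<p})" for S :: "nat set"
  \<comment> \<open>This is \<open>-1\<close> if \<open>p\<close> divides \<open>ind x\<close>, so
    \<open>b p x + 1\<close> vanishes at the nonzero \<open>p\<close>-th powers.\<close>
  define b where "b p x = - (\<Sum>j\<in>{1..<p}. e p (j * ind x)) / of_nat (p - 1)" for p and x :: 'a
  \<comment> \<open>Zero is removed because it has no discrete logarithm. The characters vanish
    there, so their sums over the coset do not change.\<close>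
  define V where "V = (\<lambda>k. \<beta> + k) ` K - {0}"
  have vanish: "(\<Prod>p\<in>P. b p x + 1) = 0" if x: "x \<in> V" for x
  proof -
    have x0: "x \<noteq> 0" and "\<not> primitive_element x" using x none by (auto simp: V_def)
    hence "\<not> coprime (ind x) N"
      using primitive_element_generator_power[OF g, of "ind x"] ind[OF x0] by (auto simp: N_def Q_def)
    then obtain p where p: "prime p" "p dvd ind x" "p dvd N"
      by (metis coprime_iff_gcd_eq_1 gcd_nat.boundedE prime_factor_nat)
    hence "p \<in> P" using N by (auto simp: P_def prime_factors_dvd)
    have "e p (j * ind x) = 1" for j using p by (intro e_dvd) (auto simp: prime_gt_0_nat)
    hence "(\<Sum>j\<in>{1..<p}. e p (j * ind x)) = of_nat (p - 1)" by simp
    hence "b p x = - 1" unfolding b_def using prime_gt_1_nat[OF p(1)] by (simp del: of_nat_diff)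
    hence "b p x + 1 = 0" by simp
    thus ?thesis using \<open>p \<in> P\<close> P(1) by auto
  qed

  define T where "T S = (\<Sum>x\<in>V. \<Prod>p\<in>S. b p x)" for S
  have "0 = (\<Sum>x\<in>V. \<Prod>p\<in>P. b p x + 1)" by (simp add: vanish)
  also have "\<dots> = (\<Sum>x\<in>V. \<Sum>S\<in>Pow P. \<Prod>p\<in>S. b p x)"
    by (simp add: prod_add P(1))
  also have "\<dots> = (\<Sum>S\<in>Pow P. T S)" unfolding T_def by (rule sum.swap)
  also have "\<dots> = of_nat (card V) + (\<Sum>S\<in>Pow P-{{}}. T S)"
    using P(1) by (subst sum.remove[of _ "{}"]) (auto simp: T_def)
  finally have "of_nat (card V) = - (\<Sum>S\<in>Pow P-{{}}. T S)" by (simp add: eq_neg_iff_add_eq_0)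
  hence "real (card V) = norm (\<Sum>S\<in>Pow P-{{}}. T S)"
    by (metis norm_minus_cancel norm_of_nat)
  also have "\<dots> \<le> (\<Sum>S\<in>Pow P-{{}}. sqrt (real Q))"
  proof (rule sum_norm_le)
    fix S assume "S \<in> Pow P - {{}}"
    hence S: "S \<subseteq> P" "S \<noteq> {}" and fin: "finite S" using P(1) finite_subset by auto
    define D where "D = (\<Prod>p\<in>S. - (1 / of_nat (p - 1)) :: complex)"
    have expand: "(\<Prod>p\<in>S. b p x) = D * (\<Sum>r\<in>R S. \<chi> S r x)" if "x \<in> V" for x
    proof -
      have "x \<noteq> 0" using that by (simp add: V_def)
      have "(\<Prod>p\<in>S. b p x) = (\<Prod>p\<in>S. - (1 / of_nat (p - 1)) * (\<Sum>j\<in>{1..<p}. e p (j * ind x)))"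
        by (simp add: b_def)
      also have "\<dots> = D * (\<Sum>r\<in>R S. \<Prod>p\<in>S. e p (r p * ind x))"
        unfolding prod.distrib D_def R_def using fin by (subst prod_sum_PiE) auto
      finally show ?thesis using \<open>x \<noteq> 0\<close> by (simp add: \<chi>_def)
    qed
    have bound: "norm (\<Sum>x\<in>V. \<chi> S r x) \<le> sqrt (real Q)" if "r \<in> R S" for r
    proof -
      have "r p \<in> {1..<p}" if "p \<in> S" for p using \<open>r \<in> R S\<close> that by (auto simp: R_def PiE_def Pi_def)
      then obtain y where y: "y \<noteq> 0" "\<chi> S r y \<noteq> 1" using nontriv[OF S, of r] by blast
      have "(\<Sum>x\<in>V. \<chi> S r x) = (\<Sum>x\<in>(\<lambda>k. \<beta> + k) ` K. \<chi> S r x)"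
        unfolding V_def by (intro sum.mono_neutral_left) (auto simp: \<chi>_def)
      also have "\<dots> = (\<Sum>k\<in>K. \<chi> S r (\<beta> + k))" by (simp add: sum.reindex)
      finally show ?thesis
        using mult_character_coset_sum[OF char[OF S(1)] y K] by (simp add: Q_def)
    qed
    have "T S = D * (\<Sum>x\<in>V. \<Sum>r\<in>R S. \<chi> S r x)"
      unfolding T_def by (simp add: expand sum_distrib_left)
    also have "(\<Sum>x\<in>V. \<Sum>r\<in>R S. \<chi> S r x) = (\<Sum>r\<in>R S. \<Sum>x\<in>V. \<chi> S r x)" by (rule sum.swap)
    finally have "norm (T S) = norm D * norm (\<Sum>r\<in>R S. \<Sum>x\<in>V. \<chi> S r x)" by (simp add: norm_mult)
    also have "\<dots> \<le> norm D * (\<Sum>r\<in>R S. sqrt (real Q))"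
      by (intro mult_left_mono sum_norm_le bound) auto
    also have "\<dots> = (norm D * real (card (R S))) * sqrt (real Q)" by simp
    \<comment> \<open>The number of characters attached to \<open>S\<close> is exactly cancelled by
      the normalising factors \<open>p - 1\<close>.\<close>
    also have "norm D * real (card (R S)) = 1"
    proof -
      have "card (R S) = (\<Prod>p\<in>S. p - 1)" unfolding R_def using fin by (simp add: card_PiE)
      moreover have "norm D = (\<Prod>p\<in>S. 1 / real (p - 1))"
        unfolding D_def by (simp add: prod_norm[symmetric] norm_divide)
      ultimately have "norm D * real (card (R S)) = (\<Prod>p\<in>S. 1 / real (p - 1) * real (p - 1))"
        by (simp only: prod.distrib of_nat_prod)
      also have "\<dots> = 1"
      proof (intro prod.neutral ballI)
        fix p assume "p \<in> S"
        hence "p > 1" using S Ppos by blast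
        thus "1 / real (p - 1) * real (p - 1) = 1" by simp
      qed
      finally show ?thesis .
    qed
    finally show "norm (T S) \<le> sqrt (real Q)" by simp
  qed
  also have "\<dots> = (2 ^ card P - 1) * sqrt (real Q)"
    using P(1) by (simp add: card_Diff_singleton card_Pow of_nat_diff)
  also have "\<dots> \<le> (real (W N) - 1) * sqrt (real Q)"
  proof (intro mult_right_mono)
    have "real (2 ^ card P) \<le> real (W N)" unfolding P_def using W_ge[OF N] by (simp only: of_nat_le_iff)
    thus "2 ^ card P - 1 \<le> real (W N) - 1" by simp
  qed simp
  finally have "real (card V) \<le> real (W N) * sqrt (real Q) - sqrt (real Q)" by (simp add: algebra_simps)
  \<comment> \<open>Deleting 0 costs at most one element. The spare
    \<open>sqrt (real Q) > 1\<close>, gained because the empty set is left out of the error terms,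
    outweighs it.\<close>
  moreover have "real (card K) - 1 \<le> real (card V)"
  proof -
    have "card K = card ((\<lambda>k. \<beta> + k) ` K)" by (simp add: card_image)
    also have "\<dots> \<le> card V + 1"
      unfolding V_def using diff_card_le_card_Diff[of "{0}" "(\<lambda>k. \<beta> + k) ` K"] by simp
    finally show ?thesis by simp
  qed
  moreover have "sqrt (real Q) > 1" using Q by simp
  ultimately show False using large unfolding N_def by linarith
qed

section \<open>Primitive elements with prescribed traces\<close>

lemma frobenius_module_prime_field:
  assumes "primepow q" "n > 0" "card (UNIV :: 'a :: finite_field set) = q ^ n"
  shows   "frobenius_module (Rep_prime_field :: 'a prime_field \<Rightarrow> 'a) q n"
proof -
  obtain p e where q: "prime p" "e > 0" "q = p ^ e"
    using assms(1) by (auto simp: primepow_def)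
  hence "CHAR('a) = p" using CHAR_eq_of_card[of p e n] assms(3) by simp
  hence qc: "q = CHAR('a) ^ e" by (simp add: q)
  show ?thesis
  proof
    show "(x + y) ^ q = x ^ q + (y :: 'a) ^ q" for x y
      by (rule freshmans_dream'[OF _ qc]) simp
    show "q > 1" using q by (metis one_less_power prime_gt_1_nat)
  qed (use assms Rep_prime_field_power_CHAR[OF qc] in
        \<open>simp_all add: one_prime_field.rep_eq plus_prime_field.rep_eq times_prime_field.rep_eq\<close>)
qed

theorem theorem2p4:
  fixes q n k :: nat and d :: "nat \<Rightarrow> nat" and a :: "nat \<Rightarrow> 'a :: finite_field"
  assumes "primepow q"
    and "n > 1" and "\<not> primepow n"
    and "card (UNIV :: 'a set) = q ^ n"
    and "1 < k" and "k < card {m. m dvd n}"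
    and "d \<in> Lam k n"
    and "a \<in> FF q k d" and "admissible q k d a"
    and "real q powr (real n / 2 - real_of_int (lam k d)) \<ge> real (W (q ^ n - 1))"
  shows "\<exists>\<alpha> :: 'a. primitive_element \<alpha> \<and> (\<forall>i\<in>{1..k}. tr q n (d i) \<alpha> = a i)"
proof -
  have n: "n > 0" using assms(2) by simp
  interpret frobenius_module "Rep_prime_field :: 'a prime_field \<Rightarrow> 'a" q n
    using assms(1) n assms(4) by (rule frobenius_module_prime_field)
  have d_dvd: "d i dvd n" if "i \<in> {1..k}" for i
    using assms(7) that unfolding Lam_def by blast
  hence d: "d i dvd n" "d i > 0" if "i \<in> {1..k}" for i
    using that n dvd_pos_nat by blast+
  \<comment> \<open>The kernel of \<open>f i\<close> is the subfield with \<open>q ^ d i\<close>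
    elements, and its cofactor \<open>h i\<close> acts as the trace onto it.\<close>
  define f where "f i = (xpow_m1 (d i) :: 'a prime_field poly)" for i
  define h where "h i = (\<Sum>t<n div d i. monom 1 (d i * t) :: 'a prime_field poly)" for i
  have fh: "f i * h i = xpow_m1 n" if "i \<in> {1..k}" for i
    using d[OF that] by (simp add: f_def h_def flip: xpow_m1_mult)
  have act_h: "act (h i) x = tr q n (d i) x" for i x
    by (simp add: h_def act_trace_poly)
  have "a i ^ (q ^ d i) = a i" if "i \<in> {1..k}" for i
    using assms(8) that d[OF that] GF_sub_eq[OF assms(1) n assms(4), of "d i"]
    by (auto simp: FF_def)
  hence fa: "act (f i) (a i) = 0" if "i \<in> {1..k}" for i
    using that by (simp add: f_def act_xpow_m1)
  \<comment> \<open>The intermediate traces in \<open>admissible\<close> are quotient actions too,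
    which turns admissibility into the compatibility condition of
    \<open>ex_common_solution\<close>.\<close>
  have act_quotient: "act (f i div xpow_m1 g) x = tr q (d i) g x"
    if "g dvd d i" "i \<in> {1..k}" for i g x
  proof -
    have "g > 0" using that(1) d(2)[OF that(2)] dvd_pos_nat by blast
    moreover have "f i = xpow_m1 g * (\<Sum>t<d i div g. monom 1 (g * t))"
      using that(1) by (simp add: f_def flip: xpow_m1_mult)
    ultimately have "f i div xpow_m1 g = (\<Sum>t<d i div g. monom 1 (g * t))" by simp
    thus ?thesis by (simp add: act_trace_poly)
  qed
  have compat: "act (f i div gcd (f i) (f j)) (a i) = act (f j div gcd (f i) (f j)) (a j)"
    if "i \<in> {1..k}" "j \<in> {1..k}" "i \<noteq> j" for i j
  proof -
    have adm: "tr q (d u) (gcd (d u) (d v)) (a u) = tr q (d v) (gcd (d u) (d v)) (a v)"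
      if "1 \<le> u" "u < v" "v \<le> k" for u v
      using assms(9) that unfolding admissible_def by blast
    have "tr q (d i) (gcd (d i) (d j)) (a i) = tr q (d j) (gcd (d i) (d j)) (a j)"
    proof (cases i j rule: linorder_cases)
      case less
      show ?thesis by (rule adm) (use that less in auto)
    next
      case greater
      have "tr q (d j) (gcd (d j) (d i)) (a j) = tr q (d i) (gcd (d j) (d i)) (a i)"
        by (rule adm) (use that greater in auto)
      thus ?thesis by (simp only: gcd.commute[of "d i" "d j"])
    qed (use that in simp)
    moreover have "gcd (f i) (f j) = xpow_m1 (gcd (d i) (d j))"
      unfolding f_def using d(2)[OF that(1)] by (rule gcd_xpow_m1)
    ultimately show ?thesis using that by (simp add: act_quotient)
  qed
  obtain \<beta> where \<beta>: "\<And>i. i \<in> {1..k} \<Longrightarrow> act (h i) \<beta> = a i"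
    using ex_common_solution[of "{1..k}" f h a] fh fa compat by blast
  \<comment> \<open>The solutions of the trace equations form the coset of \<open>K\<close> through
    \<open>\<beta>\<close>.\<close>
  define K where "K = {x. \<forall>i\<in>{1..k}. act (h i) x = 0}"

  define D where "D = degree (Lcm (f ` {1..k}))"
  have D: "int D = lam k d"
    unfolding D_def f_def lam_eq_incl_excl_gcd using d by (intro degree_Lcm_xpow_m1) auto
  have q0: "real q > 0" using q_gt_1 by simp
  have "q ^ n \<le> q ^ D * card K"
    unfolding D_def K_def by (rule card_common_kernel_ge) (rule fh)
  hence "real (q ^ n) \<le> real (q ^ D * card K)" by (simp only: of_nat_le_iff)
  hence card_K: "real q ^ n \<le> real q ^ D * real (card K)" by simp
  have sqrt_Q: "sqrt (real (q ^ n)) = real q powr (real n / 2)"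
    using q0 by (simp add: powr_half_sqrt[symmetric] powr_powr flip: powr_realpow)
  \<comment> \<open>Multiplying the assumed bound by the square root of the field size raises its
    exponent to \<open>n - D\<close>, and \<open>K\<close> has at least \<open>q ^ (n - D)\<close>
    elements.\<close>
  have "real (W (q ^ n - 1)) * sqrt (real (q ^ n)) \<le>
        real q powr (real n / 2 - real_of_int (lam k d)) * real q powr (real n / 2)"
    unfolding sqrt_Q using assms(10) by (intro mult_right_mono) auto
  also have "\<dots> = real q powr (real n - real D)"
    by (simp flip: powr_add D)
  also have "\<dots> = real q ^ n / real q ^ D"
    using q0 by (simp add: powr_diff powr_realpow)
  also have "\<dots> \<le> real (card K)"
    using card_K q0 by (simp add: divide_le_eq mult.commute)
  finally have "\<exists>k\<in>K. primitive_element (\<beta> + k)"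
    by (intro ex_primitive_element_in_coset) (auto simp: K_def act_diff assms(4))
  then obtain x where "x \<in> K" "primitive_element (\<beta> + x)" by blast
  moreover from this have "\<forall>i\<in>{1..k}. tr q n (d i) (\<beta> + x) = a i"
    using \<beta> by (simp add: K_def act_add flip: act_h)
  ultimately show ?thesis by blast
qed

end
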